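(* Let $m \ge 2$ and $n\ge 1$, and let $\mathcal{A} = (a_{i_1\cdots i_m})$ be an $m$th order $n$-dimensional completely positive tensor. Then every H-eigenvalue of $\mathcal{A}$ is nonnegative.
   Context: A real $m$th order $n$-dimensional tensor is an array $\mathcal{A} = (a_{i_1\cdots i_m})$ of real numbers indexed by $1\le i_1,\dots,i_m\le n$. For $u\in\mathbb{R}^n$, $u^m$ denotes the rank-one tensor $(u_{i_1}\cdots u_{i_m})$. $\mathbb{R}^n_+$ is the set of nonnegative vectors in $\mathbb{R}^n$. $\mathcal{A}$ is called completely positive (CP) if there are finitely many vectors $u^{(1)},\dots,u^{(r)}\in\mathbb{R}^n_+$ with $\mathcal{A}=\sum_{k=1}^r (u^{(k)})^m$. For $x\in\mathbb{C}^n$, $\mathcal{A}x^{m-1}\in\mathbb{C}^n$ is the vector with components $(\mathcal{A}x^{m-1})_i=\sum_{i_2,\dots,i_m=1}^n a_{i i_2\cdots i_m}x_{i_2}\cdots x_{i_m}$, and $x^{[m-1]}$ is the vector with $i$th component $x_i^{m-1}$. A number $\lambda\in\mathbb{C}$ is an eigenvalue of $\mathcal{A}$ with eigenvector $x\in\mathbb{C}^n$, $x\ne 0$, if $\mathcal{A}x^{m-1}=\lambda x^{[m-1]}$. If moreover $x$ is real (in which case $\lambda$ is real), $\lambda$ is called an H-eigenvalue of $\mathcal{A}$ and $x$ a corresponding H-eigenvector. *)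

theory Defs
  imports "HOL-Analysis.Analysis"
begin

text \<open>
  A real tensor of order \<open>m\<close> and dimension \<open>CARD('n)\<close> is a function from multi-indices
  \<open>[i\<^sub>1, \<dots>, i\<^sub>m]\<close>, i.e. lists over \<open>'n\<close> of length \<open>m\<close>, to the reals. The order is an explicit
  parameter of the notions below, none of which looks at values on lists of other lengths.
\<close>

type_synonym 'n tensor = "'n list \<Rightarrow> real"

definition nonneg_vectors :: "(real ^ 'n) set" where
  "nonneg_vectors = {u. \<forall>i. 0 \<le> u $ i}"

definition vec_monomial :: "'a::comm_monoid_mult ^ 'n \<Rightarrow> 'n list \<Rightarrow> 'a" where
  "vec_monomial x is = (\<Prod>i\<leftarrow>is. x $ i)"

text \<open>
  Restricted to lists of length \<open>m\<close>, \<^term>\<open>vec_monomial u\<close> is the rank-one tensor \<open>u\<^sup>m\<close>.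
\<close>

definition completely_positive :: "nat \<Rightarrow> 'n::finite tensor \<Rightarrow> bool" where
  "completely_positive m A \<longleftrightarrow>
     (\<exists>(r::nat) (u :: nat \<Rightarrow> real ^ 'n). (\<forall>k<r. u k \<in> nonneg_vectors) \<and>
        (\<forall>is. length is = m \<longrightarrow> A is = (\<Sum>k<r. vec_monomial (u k) is)))"

text \<open>The vector \<open>A x\<^bsup>m-1\<^esup>\<close>; the list \<open>is\<close> is \<open>[i\<^sub>2, \<dots>, i\<^sub>m]\<close>.\<close>

definition tensor_apply :: "nat \<Rightarrow> 'n::finite tensor \<Rightarrow> complex ^ 'n \<Rightarrow> complex ^ 'n" where
  "tensor_apply m A x =
     (\<chi> i. \<Sum>is | length is = m - 1. complex_of_real (A (i # is)) * vec_monomial x is)"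

definition tensor_eigenpair ::
    "nat \<Rightarrow> 'n::finite tensor \<Rightarrow> complex \<Rightarrow> complex ^ 'n \<Rightarrow> bool" where
  "tensor_eigenpair m A l x \<longleftrightarrow> x \<noteq> 0 \<and> tensor_apply m A x = l *s (\<chi> i. (x $ i) ^ (m - 1))"

definition H_eigenvalue :: "nat \<Rightarrow> 'n::finite tensor \<Rightarrow> complex \<Rightarrow> bool" where
  "H_eigenvalue m A l \<longleftrightarrow> (\<exists>x. tensor_eigenpair m A l x \<and> (\<forall>i. x $ i \<in> \<real>))"

end

theory Submission
  imports Defs
begin

text \<open>
  For \<open>\<A> = \<Sum>\<^sub>k (u\<^sup>k)\<^sup>m\<close> with nonnegative \<open>u\<^sup>k\<close>, and a real vector \<open>y\<close>, the multinomial
  expansion of \<open>(u\<^sup>k \<bullet> y)\<^bsup>m-1\<^esup>\<close> collapses the tensor application to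
  \<open>(\<A> y\<^bsup>m-1\<^esup>)\<^sub>i = \<Sum>\<^sub>k u\<^sup>k\<^sub>i (u\<^sup>k \<bullet> y)\<^bsup>m-1\<^esup>\<close> (lemma \<open>tensor_apply_rank_one_sum\<close>).
  Hence an H-eigenvalue \<open>\<lambda>\<close> is real and satisfies
  \<open>\<Sum>\<^sub>k u\<^sup>k\<^sub>i (u\<^sup>k \<bullet> y)\<^bsup>m-1\<^esup> = \<lambda> y\<^sub>i\<^bsup>m-1\<^esup>\<close> for all \<open>i\<close>. The parity of \<open>m\<close> decides where
  its sign can be read off.

  If \<open>m\<close> is odd, the exponent \<open>m - 1\<close> is even, so for a single \<open>i\<close> with \<open>y\<^sub>i \<noteq> 0\<close> the left side
  is nonnegative (here \<open>u\<^sup>k\<^sub>i \<ge> 0\<close> enters) and \<open>y\<^sub>i\<^bsup>m-1\<^esup>\<close> is positive.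

  If \<open>m\<close> is even, a single component need not have a sign, but contracting once more
  with \<open>y\<close> gives \<open>\<Sum>\<^sub>k (u\<^sup>k \<bullet> y)\<^sup>m = \<lambda> \<Sum>\<^sub>i y\<^sub>i\<^sup>m\<close>, where only even powers occur and the sum
  on the right is positive.
\<close>

text \<open>
  Expanding a product of \<open>p\<close> equal sums chooses one summand per factor, and such choices are
  exactly the lists of length \<open>p\<close>.
\<close>

lemma sum_prod_list_over_length:
  fixes f :: "'n::finite \<Rightarrow> 'a::comm_semiring_1"
  shows "(\<Sum>is | length is = p. \<Prod>i\<leftarrow>is. f i) = (\<Sum>i\<in>UNIV. f i) ^ p"
proof (induction p)
  case 0
  have "{is :: 'n list. length is = 0} = {[]}" by auto
  then show ?case by simp
next
  case (Suc p)
  have split: "{is. length is = Suc p} = (\<lambda>(i, is). i # is) ` (UNIV \<times> {is :: 'n list. length is = p})"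
    by (auto simp: length_Suc_conv)
  have "inj_on (\<lambda>(i, is). i # is) (UNIV \<times> {is :: 'n list. length is = p})"
    by (auto simp: inj_on_def)
  then have "(\<Sum>is | length is = Suc p. \<Prod>i\<leftarrow>is. f i)
      = (\<Sum>(i, is)\<in>UNIV \<times> {is. length is = p}. f i * (\<Prod>i\<leftarrow>is. f i))"
    unfolding split by (simp add: sum.reindex case_prod_unfold)
  also have "\<dots> = (\<Sum>i\<in>UNIV. f i) * (\<Sum>is | length is = p. \<Prod>i\<leftarrow>is. f i)"
    by (simp add: sum_product sum.cartesian_product)
  finally show ?case using Suc.IH by simp
qed

lemma vec_monomial_of_real:
  "vec_monomial (\<chi> i. complex_of_real (y $ i)) is = complex_of_real (vec_monomial y is)"
  by (induction "is") (auto simp: vec_monomial_def)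

lemma sum_vec_monomial_mult:
  fixes u y :: "real ^ 'n::finite"
  shows "(\<Sum>is | length is = p. vec_monomial u is * vec_monomial y is) = (u \<bullet> y) ^ p"
proof -
  have "vec_monomial u is * vec_monomial y is = (\<Prod>i\<leftarrow>is. u $ i * y $ i)" for "is"
    by (induction "is") (auto simp: vec_monomial_def)
  then show ?thesis
    by (simp add: sum_prod_list_over_length inner_vec_def)
qed

lemma tensor_apply_rank_one_sum:
  fixes A :: "'n::finite tensor" and u :: "nat \<Rightarrow> real ^ 'n"
  assumes "m \<ge> 1"
    and A: "\<And>is. length is = m \<Longrightarrow> A is = (\<Sum>k<r. vec_monomial (u k) is)"
  shows "tensor_apply m A (\<chi> i. complex_of_real (y $ i)) $ i
      = complex_of_real (\<Sum>k<r. u k $ i * (u k \<bullet> y) ^ (m - 1))"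
proof -
  have "(\<Sum>is | length is = m - 1. A (i # is) * vec_monomial y is)
      = (\<Sum>is | length is = m - 1. \<Sum>k<r. u k $ i * (vec_monomial (u k) is * vec_monomial y is))"
    using assms by (intro sum.cong) (auto simp: vec_monomial_def sum_distrib_right mult.assoc)
  also have "\<dots> = (\<Sum>k<r. u k $ i * (u k \<bullet> y) ^ (m - 1))"
    by (subst sum.swap) (simp add: sum_distrib_left[symmetric] sum_vec_monomial_mult)
  finally show ?thesis
    by (simp add: tensor_apply_def vec_monomial_of_real flip: of_real_mult of_real_sum)
qed

text \<open>
  The eigenvalue equation in real form: \<open>\<lambda>\<close> is forced to be real because some component of
  the eigenvector is nonzero and can be divided by.
\<close>

lemma H_eigenvalue_rank_one_sumE:
  fixes A :: "'n::finite tensor" and u :: "nat \<Rightarrow> real ^ 'n"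
  assumes m: "m \<ge> 1"
    and A: "\<And>is. length is = m \<Longrightarrow> A is = (\<Sum>k<r. vec_monomial (u k) is)"
    and H: "H_eigenvalue m A l"
  obtains c :: real and y :: "real ^ 'n" and j where "l = complex_of_real c" and "y $ j \<noteq> 0"
    and "\<And>i. (\<Sum>k<r. u k $ i * (u k \<bullet> y) ^ (m - 1)) = c * (y $ i) ^ (m - 1)"
proof -
  obtain x where x: "x \<noteq> 0" "tensor_apply m A x = l *s (\<chi> i. (x $ i) ^ (m - 1))"
    and real: "\<forall>i. x $ i \<in> \<real>"
    using H by (auto simp: H_eigenvalue_def tensor_eigenpair_def)
  define y :: "real ^ 'n" where "y = (\<chi> i. Re (x $ i))"
  define b where "b i = (\<Sum>k<r. u k $ i * (u k \<bullet> y) ^ (m - 1))" for i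
  have xy: "x = (\<chi> i. complex_of_real (y $ i))"
    using real by (simp add: y_def vec_eq_iff)
  have eq: "complex_of_real (b i) = l * complex_of_real ((y $ i) ^ (m - 1))" for i
    using arg_cong[OF x(2), of "\<lambda>v. v $ i"] tensor_apply_rank_one_sum[OF m A, of y i]
    by (simp add: xy b_def)
  obtain j where j: "y $ j \<noteq> 0"
    using x(1) by (auto simp: xy vec_eq_iff)
  define c where "c = b j / (y $ j) ^ (m - 1)"
  have l: "l = complex_of_real c"
    using eq[of j] j by (simp add: c_def)
  have "b i = c * (y $ i) ^ (m - 1)" for i
    using eq[of i] unfolding l by (simp flip: of_real_mult of_real_power)
  then show thesis using that l j by (simp add: b_def)
qed

theorem theorem1:
  fixes A :: "'n::finite tensor" and m :: nat and l :: complex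
  assumes "m \<ge> 2"
    and "completely_positive m A"
    and "H_eigenvalue m A l"
  shows "l \<in> \<real>\<^sub>\<ge>\<^sub>0"
proof -
  obtain r and u :: "nat \<Rightarrow> real ^ 'n"
    where u: "\<And>k i. k < r \<Longrightarrow> 0 \<le> u k $ i"
      and A: "\<And>is. length is = m \<Longrightarrow> A is = (\<Sum>k<r. vec_monomial (u k) is)"
    using assms(2) by (auto simp: completely_positive_def nonneg_vectors_def)
  have m: "m \<ge> 1" using assms(1) by simp
  then obtain p where p: "m = Suc p" by (cases m) auto
  obtain c y j where l: "l = complex_of_real c" and j: "y $ j \<noteq> 0"
    and eq: "\<And>i. (\<Sum>k<r. u k $ i * (u k \<bullet> y) ^ p) = c * (y $ i) ^ p"
    using H_eigenvalue_rank_one_sumE[OF m A assms(3)] unfolding p diff_Suc_1 by blast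
  have "c \<ge> 0"
  proof (cases "even m")
    case True
    have "(\<Sum>k<r. (u k \<bullet> y) ^ m) = (\<Sum>k<r. (u k \<bullet> y) * (u k \<bullet> y) ^ p)"
      by (simp add: p)
    also have "\<dots> = (\<Sum>k<r. \<Sum>i\<in>UNIV. y $ i * (u k $ i * (u k \<bullet> y) ^ p))"
      \<comment> \<open>Only the first factor is expanded, as \<open>u\<^sup>k \<bullet> y = \<Sum>\<^sub>i u\<^sup>k\<^sub>i y\<^sub>i\<close>.\<close>
      by (subst (1) inner_vec_def) (simp add: sum_distrib_left mult_ac)
    also have "\<dots> = (\<Sum>i\<in>UNIV. y $ i * (c * (y $ i) ^ p))"
      by (subst sum.swap) (simp add: eq flip: sum_distrib_left)
    also have "\<dots> = c * (\<Sum>i\<in>UNIV. (y $ i) ^ m)"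
      by (simp add: sum_distrib_left mult.left_commute p)
    finally have "c * (\<Sum>i\<in>UNIV. (y $ i) ^ m) \<ge> 0"
      using True by (metis sum_nonneg zero_le_even_power)
    moreover have "(\<Sum>i\<in>UNIV. (y $ i) ^ m) > 0"
      using True j by (intro sum_pos2[of _ j]) (auto simp: zero_less_power_eq zero_le_even_power)
    ultimately show ?thesis by (simp add: zero_le_mult_iff)
  next
    case False
    then have "even p" by (simp add: p)
    then have "c * (y $ j) ^ p \<ge> 0" and "(y $ j) ^ p > 0"
      using u j by (auto simp: zero_less_power_eq zero_le_even_power simp flip: eq intro!: sum_nonneg)
    then show ?thesis by (simp add: zero_le_mult_iff)
  qed
  then show ?thesis by (simp add: l)
qed

end
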